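(* Let $\mathcal G$ and $\mathcal H$ be graphs. (i) If $f\colon V(\mathcal G)\to V(\mathcal H)$ is a pullback, then the map $\theta_f\colon D_{V(\mathcal H)}\to D_{V(\mathcal G)}$ defined by $$\theta_f\Big(\sum_{w\in V(\mathcal H)}\lambda_w\varepsilon_{ww}\Big)=\sum_{i\in V(\mathcal G)}\lambda_{f(i)}\varepsilon_{ii}$$ is a unital $*$-homomorphism that satisfies $\mathcal S_{\mathcal G}=\mathcal S_{\mathcal H}^{\leftarrow\theta_f}$. (ii) Conversely, let $\theta\colon D_{V(\mathcal H)}\to D_{V(\mathcal G)}$ be a unital $*$-homomorphism such that $\mathcal S_{\mathcal G}=\mathcal S_{\mathcal H}^{\leftarrow\theta}$. Then there exists a unique pullback $f\colon V(\mathcal G)\to V(\mathcal H)$ such that $\theta=\theta_f$. In addition, for a pullback $f\colon V(\mathcal G)\to V(\mathcal H)$, the following are equivalent: $f$ is surjective; $\theta_f$ is injective; $[\mathcal X_{\theta_f}\mathbb C^{V(\mathcal G)}]=\mathbb C^{V(\mathcal H)}$.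
   Context: All graphs are finite, simple and undirected. Write $x\simeq_{\mathcal G}y$ if $x=y$ or $x$ is adjacent to $y$ in $\mathcal G$. A pullback is a map $f\colon V(\mathcal G)\to V(\mathcal H)$ with $x\simeq_{\mathcal G}y\iff f(x)\simeq_{\mathcal H}f(y)$ for all $x,y\in V(\mathcal G)$. $M_{V(\mathcal G)}$ denotes the matrices indexed by $V(\mathcal G)$, acting on $\mathbb C^{V(\mathcal G)}$, with matrix units $\varepsilon_{xy}$, and $D_{V(\mathcal G)}\subseteq M_{V(\mathcal G)}$ the diagonal matrices. The graph operator system is $\mathcal S_{\mathcal G}=\operatorname{span}\{\varepsilon_{xy}: x\simeq_{\mathcal G}y\}\subseteq M_{V(\mathcal G)}$. For a unital completely positive map $\varphi\colon D_{V(\mathcal H)}\to D_{V(\mathcal G)}$ with Kraus representation $\varphi(b)=\sum_{i=1}^rv_i^*bv_i$, $v_i\colon\mathbb C^{V(\mathcal G)}\to\mathbb C^{V(\mathcal H)}$, set $\mathcal S_{\mathcal H}^{\leftarrow\varphi}$ to be the $D_{V(\mathcal G)}$-bimodule (linear subspace of $M_{V(\mathcal G)}$) generated by $\{v_i^*tv_j: t\in\mathcal S_{\mathcal H},\ i,j\in\{1,\dots,r\}\}$, and $\mathcal X_\varphi=\operatorname{span}\{bv_ia: b\in D_{V(\mathcal H)},\ a\in D_{V(\mathcal G)},\ i=1,\dots,r\}$ (note that the diagonal algebras equal their own commutants). Both are independent of the choice of Kraus representation. $[\mathcal XH]$ denotes the linear span of $\{x\xi: x\in\mathcal X,\ \xi\in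 H\}$. *)

theory Defs
  imports "HOL-Analysis.Analysis"
begin

text \<open>
  A graph is an irreflexive symmetric adjacency relation on a finite vertex type (so vertex sets
  are nonempty). A matrix in
  \<^typ>\<open>complex^'g^'h\<close> has rows indexed by \<^typ>\<open>'h\<close> and columns indexed by \<^typ>\<open>'g\<close>, so it is a
  linear map from $\mathbb C^{V(\mathcal G)}$ to $\mathbb C^{V(\mathcal H)}$.
\<close>

definition simple_graph :: "('g \<Rightarrow> 'g \<Rightarrow> bool) \<Rightarrow> bool" where
  "simple_graph E \<longleftrightarrow> symp E \<and> irreflp E"

definition adj_or_eq :: "('g \<Rightarrow> 'g \<Rightarrow> bool) \<Rightarrow> 'g \<Rightarrow> 'g \<Rightarrow> bool" where
  "adj_or_eq E x y \<longleftrightarrow> x = y \<or> E x y"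

definition graph_pullback ::
    "('g \<Rightarrow> 'g \<Rightarrow> bool) \<Rightarrow> ('h \<Rightarrow> 'h \<Rightarrow> bool) \<Rightarrow> ('g \<Rightarrow> 'h) \<Rightarrow> bool" where
  "graph_pullback EG EH f \<longleftrightarrow> (\<forall>x y. adj_or_eq EG x y \<longleftrightarrow> adj_or_eq EH (f x) (f y))"


text \<open>
  The library's \<open>*s\<close> only scales vectors by their entry type and \<open>*\<^sub>R\<close> only by reals, so the
  complex vector space structure on matrices is set up here.
\<close>

definition mat_scale :: "complex \<Rightarrow> complex^'n^'m \<Rightarrow> complex^'n^'m" where
  "mat_scale c A = (\<chi> i j. c * A $ i $ j)"

interpretation cmat: vector_space "mat_scale :: complex \<Rightarrow> complex^'n^'m \<Rightarrow> complex^'n^'m"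
  by unfold_locales (simp_all add: mat_scale_def vec_eq_iff algebra_simps)

definition mat_adj :: "complex^'n^'m \<Rightarrow> complex^'m^'n" where
  "mat_adj A = (\<chi> i j. cnj (A $ j $ i))"

definition mat_unit :: "'m \<Rightarrow> 'n \<Rightarrow> complex^'n^'m" where
  "mat_unit x y = (\<chi> i j. if i = x \<and> j = y then 1 else 0)"

definition diag_alg :: "(complex^'n^'n) set" where
  "diag_alg = {A. \<forall>i j. i \<noteq> j \<longrightarrow> A $ i $ j = 0}"

definition graph_system :: "('g \<Rightarrow> 'g \<Rightarrow> bool) \<Rightarrow> (complex^'g^'g) set" where
  "graph_system E = cmat.span {mat_unit x y | x y. adj_or_eq E x y}"


text \<open>
  A map $D_{V(\mathcal H)} \to D_{V(\mathcal G)}$ is a function on all matrices of which only the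
  values on \<^const>\<open>diag_alg\<close> are relevant.
\<close>

definition unital_star_hom :: "(complex^'h^'h \<Rightarrow> complex^'g^'g) \<Rightarrow> bool" where
  "unital_star_hom \<theta> \<longleftrightarrow>
     (\<forall>a\<in>diag_alg. \<theta> a \<in> diag_alg) \<and>
     (\<forall>a\<in>diag_alg. \<forall>b\<in>diag_alg. \<theta> (a + b) = \<theta> a + \<theta> b) \<and>
     (\<forall>c. \<forall>a\<in>diag_alg. \<theta> (mat_scale c a) = mat_scale c (\<theta> a)) \<and>
     (\<forall>a\<in>diag_alg. \<forall>b\<in>diag_alg. \<theta> (a ** b) = \<theta> a ** \<theta> b) \<and>
     (\<forall>a\<in>diag_alg. \<theta> (mat_adj a) = mat_adj (\<theta> a)) \<and>
     \<theta> (mat 1) = mat 1"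

definition theta :: "('g \<Rightarrow> 'h) \<Rightarrow> complex^'h^'h \<Rightarrow> complex^'g^'g" where
  "theta f b = (\<Sum>i\<in>UNIV. mat_scale (b $ f i $ f i) (mat_unit i i))"

definition kraus_rep ::
    "(complex^'h^'h \<Rightarrow> complex^'g^'g) \<Rightarrow> (complex^'g^'h) list \<Rightarrow> bool" where
  "kraus_rep \<phi> vs \<longleftrightarrow>
     (\<forall>b\<in>diag_alg. \<phi> b = (\<Sum>v\<leftarrow>vs. mat_adj v ** b ** v))"

definition diag_bimodule :: "(complex^'g^'g) set \<Rightarrow> bool" where
  "diag_bimodule K \<longleftrightarrow> cmat.subspace K \<and>
     (\<forall>a\<in>diag_alg. \<forall>b\<in>diag_alg. \<forall>k\<in>K. a ** k ** b \<in> K)"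

definition kraus_system ::
    "('h \<Rightarrow> 'h \<Rightarrow> bool) \<Rightarrow> (complex^'g^'h) list \<Rightarrow> (complex^'g^'g) set" where
  "kraus_system EH vs =
     diag_bimodule hull
       {mat_adj v ** t ** w | v t w. v \<in> set vs \<and> w \<in> set vs \<and> t \<in> graph_system EH}"

definition kraus_space :: "(complex^'g^'h) list \<Rightarrow> (complex^'g^'h) set" where
  "kraus_space vs =
     cmat.span {b ** v ** a | b v a. b \<in> diag_alg \<and> v \<in> set vs \<and> a \<in> diag_alg}"

text \<open>
  $\mathcal S_{\mathcal H}^{\leftarrow\varphi}$ and $\mathcal X_\varphi$, computed from an arbitrary
  Kraus representation; the choice is irrelevant by \<open>pullback_system_eq\<close> and
  \<open>bimodule_of_eq\<close> below. They are meaningful for completely positive maps only, that is,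
  when a Kraus representation exists.
\<close>

definition pullback_system ::
    "('h \<Rightarrow> 'h \<Rightarrow> bool) \<Rightarrow> (complex^'h^'h \<Rightarrow> complex^'g^'g) \<Rightarrow> (complex^'g^'g) set" where
  "pullback_system EH \<phi> = kraus_system EH (SOME vs. kraus_rep \<phi> vs)"

definition bimodule_of ::
    "(complex^'h^'h \<Rightarrow> complex^'g^'g) \<Rightarrow> (complex^'g^'h) set" where
  "bimodule_of \<phi> = kraus_space (SOME vs. kraus_rep \<phi> vs)"

definition range_span :: "(complex^'g^'h) set \<Rightarrow> (complex^'h) set" where
  "range_span X = vec.span {x *v \<xi> | x \<xi>. x \<in> X}"


lemma mat_unit_nth: "mat_unit x y $ i $ j = (if i = x \<and> j = y then 1 else 0)"
  by (simp add: mat_unit_def)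

lemma mat_scale_nth: "mat_scale c A $ i $ j = c * A $ i $ j"
  by (simp add: mat_scale_def)

lemma mat_unit_diag: "mat_unit x x \<in> diag_alg"
  by (simp add: diag_alg_def mat_unit_nth)

lemma diag_mult_nth:
  assumes "a \<in> diag_alg" "b \<in> diag_alg"
  shows "(a ** m ** b) $ x $ y = a $ x $ x * m $ x $ y * b $ y $ y"
proof -
  have 1: "(a ** m) $ i $ j = a $ i $ i * m $ i $ j" for i j
    using assms(1) sum.remove[of UNIV i "\<lambda>k. a $ i $ k * m $ k $ j"]
    by (simp add: matrix_matrix_mult_def diag_alg_def)
  have 2: "(c ** b) $ i $ j = c $ i $ j * b $ j $ j" for c :: "complex^'b^'a" and i j
    using assms(2) sum.remove[of UNIV j "\<lambda>k. c $ i $ k * b $ k $ j"]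
    by (simp add: matrix_matrix_mult_def diag_alg_def)
  show ?thesis by (simp add: 1 2)
qed

lemma mat_unit_mult_nth:
  "(mat_unit x x ** m ** mat_unit y y) = mat_scale (m $ x $ y) (mat_unit x y)"
  by (auto simp: vec_eq_iff diag_mult_nth[OF mat_unit_diag mat_unit_diag] mat_scale_nth mat_unit_nth)

lemma mat_unit_expand: "m = (\<Sum>x\<in>UNIV. \<Sum>y\<in>UNIV. mat_scale (m $ x $ y) (mat_unit x y))"
proof -
  have "(\<Sum>x\<in>UNIV. \<Sum>y\<in>UNIV. mat_scale (m $ x $ y) (mat_unit x y)) $ i $ j = m $ i $ j" for i j
  proof -
    have "(\<Sum>x\<in>UNIV. \<Sum>y\<in>UNIV. mat_scale (m $ x $ y) (mat_unit x y)) $ i $ j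
        = (\<Sum>x\<in>UNIV. \<Sum>y\<in>UNIV. if j = y then (if i = x then m $ x $ y else 0) else 0)"
      unfolding sum_component mat_scale_nth mat_unit_nth by (intro sum.cong refl) auto
    also have "\<dots> = m $ i $ j"
      by (simp only: sum.delta' finite UNIV_I if_True)
    finally show ?thesis .
  qed
  then show ?thesis by (simp add: vec_eq_iff)
qed

text \<open>
  Bimodules over the diagonal algebras are determined by the positions at which their elements
  may be nonzero.
\<close>

definition supported :: "(complex^'n^'m) set \<Rightarrow> (complex^'n^'m) set" where
  "supported K = {m. \<forall>x y. m $ x $ y \<noteq> 0 \<longrightarrow> (\<exists>k\<in>K. k $ x $ y \<noteq> 0)}"

lemma subspace_supported: "cmat.subspace (supported K)"
  unfolding cmat.subspace_def supported_def
  by (auto simp: mat_scale_nth) (metis add_0)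

lemma supported_subset:
  assumes sub: "cmat.subspace T" and KT: "K \<subseteq> T"
    and cl: "\<And>k x y. k \<in> K \<Longrightarrow> mat_unit x x ** k ** mat_unit y y \<in> T"
  shows "supported K \<subseteq> T"
proof
  fix m assume m: "m \<in> supported K"
  have "mat_scale (m $ x $ y) (mat_unit x y) \<in> T" for x y
  proof (cases "m $ x $ y = 0")
    case True
    then show ?thesis using cmat.subspace_0[OF sub] by simp
  next
    case False
    then obtain k where k: "k \<in> K" "k $ x $ y \<noteq> 0"
      using m by (auto simp: supported_def)
    have "mat_scale (m $ x $ y / k $ x $ y) (mat_unit x x ** k ** mat_unit y y) \<in> T"
      using cl[OF k(1)] cmat.subspace_scale[OF sub] by blast
    then show ?thesis using k(2) by (simp add: mat_unit_mult_nth)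
  qed
  then show "m \<in> T"
    by (subst mat_unit_expand) (intro cmat.subspace_sum[OF sub])
qed

lemma diag_bimodule_hull: "diag_bimodule hull K = supported K"
proof (rule hull_unique)
  show "K \<subseteq> supported K" by (auto simp: supported_def)
  show "diag_bimodule (supported K)"
    unfolding diag_bimodule_def
    using subspace_supported by (auto simp: supported_def diag_mult_nth)
  fix T assume "K \<subseteq> T" "diag_bimodule T"
  then show "supported K \<subseteq> T"
    by (intro supported_subset) (auto simp: diag_bimodule_def mat_unit_diag)
qed

lemma kraus_space_supported: "kraus_space vs = supported (set vs)"
proof
  let ?A = "{b ** v ** a | b v a. b \<in> diag_alg \<and> v \<in> set vs \<and> a \<in> diag_alg}"
  show "kraus_space vs \<subseteq> supported (set vs)"
    unfolding kraus_space_def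
    by (rule cmat.span_minimal[OF _ subspace_supported]) (auto simp: supported_def diag_mult_nth)
  have in_A: "b ** v ** a \<in> kraus_space vs"
    if "b \<in> diag_alg" "v \<in> set vs" "a \<in> diag_alg" for b v a
    unfolding kraus_space_def using that by (intro cmat.span_base) blast
  have one: "mat 1 \<in> diag_alg" by (simp add: diag_alg_def mat_def)
  show "supported (set vs) \<subseteq> kraus_space vs"
  proof (rule supported_subset)
    show "cmat.subspace (kraus_space vs)"
      unfolding kraus_space_def by (rule cmat.subspace_span)
    show "mat_unit x x ** k ** mat_unit y y \<in> kraus_space vs" if "k \<in> set vs" for k x y
      using in_A[OF mat_unit_diag that mat_unit_diag] .
    show "set vs \<subseteq> kraus_space vs"
      using in_A[OF one _ one] by auto
  qed
qed

lemma mult_mat_unit_nth: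
  "(mat_adj v ** mat_unit w z ** u) $ x $ y = cnj (v $ w $ x) * u $ z $ y"
proof -
  have "(mat_adj v ** mat_unit w z) $ x $ k = (if k = z then cnj (v $ w $ x) else 0)" for k
  proof -
    have "(mat_adj v ** mat_unit w z) $ x $ k
        = (\<Sum>l\<in>UNIV. if l = w then (if k = z then cnj (v $ l $ x) else 0) else 0)"
      unfolding matrix_matrix_mult_def mat_adj_def vec_lambda_beta mat_unit_nth
      by (intro sum.cong refl) auto
    then show ?thesis by simp
  qed
  then have "(mat_adj v ** mat_unit w z ** u) $ x $ y
      = (\<Sum>k\<in>UNIV. (if k = z then cnj (v $ w $ x) else 0) * u $ k $ y)"
    by (subst matrix_matrix_mult_def) simp
  also have "\<dots> = (\<Sum>k\<in>UNIV. if k = z then cnj (v $ w $ x) * u $ k $ y else 0)"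
    by (intro sum.cong) auto
  finally show ?thesis by simp
qed

lemma kraus_nonzero_iff:
  assumes "kraus_rep \<phi> vs"
  shows "(\<exists>v\<in>set vs. v $ w $ x \<noteq> 0) \<longleftrightarrow> \<phi> (mat_unit w w) $ x $ x \<noteq> 0"
proof -
  have sum_nth: "(\<Sum>v\<leftarrow>us. mat_adj v ** mat_unit w w ** v) $ x $ x
      = of_real (\<Sum>v\<leftarrow>us. (cmod (v $ w $ x))\<^sup>2)" for us :: "(complex^'b^'a) list"
    by (induction us)
      (simp_all add: mult_mat_unit_nth complex_mult_cnj cmod_power2 mult.commute[of "cnj _"])
  have zero: "(\<Sum>v\<leftarrow>us. (cmod (v $ w $ x))\<^sup>2) = 0 \<longleftrightarrow> (\<forall>v\<in>set us. v $ w $ x = 0)"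
    for us :: "(complex^'b^'a) list"
    by (subst sum_list_nonneg_eq_0_iff) auto
  have "\<phi> (mat_unit w w) $ x $ x = of_real (\<Sum>v\<leftarrow>vs. (cmod (v $ w $ x))\<^sup>2)"
    using assms by (simp add: kraus_rep_def mat_unit_diag sum_nth)
  then show ?thesis using zero[of vs] by simp
qed

lemma graph_system_nth_eq_0:
  assumes "t \<in> graph_system E" "\<not> adj_or_eq E w z"
  shows "t $ w $ z = 0"
proof -
  have "graph_system E \<subseteq> {t. t $ w $ z = 0}"
    unfolding graph_system_def using assms(2)
    by (intro cmat.span_minimal) (auto simp: mat_unit_nth cmat.subspace_def mat_scale_nth)
  then show ?thesis using assms(1) by blast
qed

lemma kraus_system_eq:
  assumes "kraus_rep \<phi> vs"
  shows "kraus_system EH vs =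
    {m. \<forall>x y. m $ x $ y \<noteq> 0 \<longrightarrow> (\<exists>w z. adj_or_eq EH w z \<and>
      \<phi> (mat_unit w w) $ x $ x \<noteq> 0 \<and> \<phi> (mat_unit z z) $ y $ y \<noteq> 0)}"
proof -
  let ?K = "{mat_adj v ** t ** w | v t w. v \<in> set vs \<and> w \<in> set vs \<and> t \<in> graph_system EH}"
  have "(\<exists>k\<in>?K. k $ x $ y \<noteq> 0) \<longleftrightarrow> (\<exists>w z. adj_or_eq EH w z \<and>
      \<phi> (mat_unit w w) $ x $ x \<noteq> 0 \<and> \<phi> (mat_unit z z) $ y $ y \<noteq> 0)" (is "?L \<longleftrightarrow> ?R") for x y
  proof
    assume ?L
    then obtain v t u where vu: "v \<in> set vs" "u \<in> set vs" "t \<in> graph_system EH"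
      and nz: "(mat_adj v ** t ** u) $ x $ y \<noteq> 0" by blast
    have "(mat_adj v ** t ** u) $ x $ y
        = (\<Sum>z\<in>UNIV. (\<Sum>w\<in>UNIV. cnj (v $ w $ x) * t $ w $ z) * u $ z $ y)"
      by (simp add: matrix_matrix_mult_def mat_adj_def)
    with nz obtain z where "(\<Sum>w\<in>UNIV. cnj (v $ w $ x) * t $ w $ z) * u $ z $ y \<noteq> 0"
      by (metis (mono_tags, lifting) sum.neutral)
    moreover from this obtain w where "cnj (v $ w $ x) * t $ w $ z \<noteq> 0"
      by (metis (mono_tags, lifting) mult_zero_left sum.neutral)
    ultimately have "v $ w $ x \<noteq> 0" "t $ w $ z \<noteq> 0" "u $ z $ y \<noteq> 0" by auto
    then show ?R
      using vu graph_system_nth_eq_0 kraus_nonzero_iff[OF assms] by blast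
  next
    assume ?R
    then obtain w z v u where "adj_or_eq EH w z" "v \<in> set vs" "u \<in> set vs"
      and nz: "v $ w $ x \<noteq> 0" "u $ z $ y \<noteq> 0"
      using kraus_nonzero_iff[OF assms] by metis
    moreover from this have "mat_unit w z \<in> graph_system EH"
      unfolding graph_system_def by (intro cmat.span_base) blast
    ultimately have "mat_adj v ** mat_unit w z ** u \<in> ?K" by blast
    moreover have "(mat_adj v ** mat_unit w z ** u) $ x $ y \<noteq> 0"
      using nz by (simp add: mult_mat_unit_nth)
    ultimately show ?L by blast
  qed
  then show ?thesis
    unfolding kraus_system_def diag_bimodule_hull supported_def by simp
qed

lemma pullback_system_eq:
  assumes "kraus_rep \<phi> vs"
  shows "pullback_system EH \<phi> = kraus_system EH vs"
  unfolding pullback_system_def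
  using kraus_system_eq[OF assms] kraus_system_eq[OF someI[of "kraus_rep \<phi>", OF assms]] by simp

lemma bimodule_of_eq:
  assumes "kraus_rep \<phi> vs"
  shows "bimodule_of \<phi> = kraus_space vs"
  unfolding bimodule_of_def kraus_space_supported supported_def
  using kraus_nonzero_iff[OF assms] kraus_nonzero_iff[OF someI[of "kraus_rep \<phi>", OF assms]]
  by simp

end

theory Submission
  imports Defs
begin

text \<open>
  The map \<^term>\<open>theta f\<close> has Kraus operators $\varepsilon_{f(i)\,i}$, $i \in V(\mathcal G)$, so the
  pulled-back system consists of the matrices supported on the pairs $(x,y)$ with
  $f(x) \simeq_{\mathcal H} f(y)$; comparing supports, it equals $\mathcal S_{\mathcal G}$
  precisely when $f$ is a pullback. Conversely, composing a unital $*$-homomorphism with the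
  evaluation at a vertex $x$ gives a character of $D_{V(\mathcal H)}$, and characters of
  $D_{V(\mathcal H)}$ are evaluations at a vertex $f(x)$ of $\mathcal H$.
\<close>

section \<open>Entries and Kraus operators of \<open>theta f\<close>\<close>

lemma theta_nth: "theta f b $ x $ y = (if x = y then b $ f x $ f x else 0)"
proof -
  have "theta f b $ x $ y = (\<Sum>i\<in>UNIV. if i = x then (if x = y then b $ f x $ f x else 0) else 0)"
    unfolding theta_def sum_component mat_scale_nth mat_unit_nth
    by (intro sum.cong refl) auto
  then show ?thesis by simp
qed

text \<open>By \<open>kraus_nonzero_iff\<close>, these diagonal entries decide where some Kraus
  operator is nonzero. For \<open>theta f\<close> these are exactly the positions
  \<open>(f x, x)\<close>, whichever Kraus representation is chosen.\<close>

lemma theta_mat_unit_nth: "theta f (mat_unit w w) $ x $ x \<noteq> 0 \<longleftrightarrow> w = f x"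
  by (auto simp: theta_nth mat_unit_nth)

lemma diag_alg_mult_nth:
  assumes "a \<in> diag_alg" "b \<in> diag_alg"
  shows "(a ** b) $ x $ y = (if x = y then a $ x $ x * b $ x $ x else 0)"
proof -
  \<comment> \<open>The identity is inserted as middle factor so that the three-factor formula
    \<open>diag_mult_nth\<close> applies.\<close>
  have "(a ** b) $ x $ y = a $ x $ x * mat 1 $ x $ y * b $ y $ y"
    using diag_mult_nth[OF assms, of "mat 1" x y] by simp
  then show ?thesis by (simp add: mat_def)
qed

lemma diag_algD: "a \<in> diag_alg \<Longrightarrow> x \<noteq> y \<Longrightarrow> a $ x $ y = 0"
  by (simp add: diag_alg_def)

lemma zero_diag_alg: "0 \<in> diag_alg"
  by (simp add: diag_alg_def)

lemma mult_diag_alg: "a \<in> diag_alg \<Longrightarrow> b \<in> diag_alg \<Longrightarrow> a ** b \<in> diag_alg"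
  by (subst diag_alg_def) (simp add: diag_alg_mult_nth)

lemma theta_diag_alg: "theta f b \<in> diag_alg"
  by (simp add: diag_alg_def theta_nth)

lemma unital_star_hom_theta: "unital_star_hom (theta f)"
  unfolding unital_star_hom_def
  by (auto simp: vec_eq_iff theta_nth theta_diag_alg diag_alg_mult_nth mat_scale_nth mat_adj_def
      mat_def)

text \<open>Conjugating \<open>b\<close> by the matrix unit at \<open>(f i, i)\<close> leaves
  \<open>b $ f i $ f i\<close> at position \<open>(i, i)\<close>. Since \<open>xs\<close> lists
  every vertex exactly once, the sum over the list is the sum defining
  \<open>theta f\<close>.\<close>

lemma kraus_rep_theta:
  fixes f :: "'g::finite \<Rightarrow> 'h::finite"
  assumes "distinct xs" "set xs = UNIV"
  shows "kraus_rep (theta f) (map (\<lambda>i. mat_unit (f i) i) xs)"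
  unfolding kraus_rep_def
proof (intro ballI)
  fix b :: "complex^'h^'h"
  have "mat_adj (mat_unit (f i) i) ** b ** mat_unit (f i) i
      = mat_scale (b $ f i $ f i) (mat_unit i i)" for i :: 'g
    unfolding vec_eq_iff
  proof (intro allI)
    fix x y
    have "(\<Sum>l\<in>UNIV. mat_adj (mat_unit (f i) i) $ x $ l * b $ l $ k)
        = (if x = i then b $ f i $ k else 0)" for k
      by (simp add: mat_adj_def mat_unit_nth if_distrib[of cnj] if_distrib[of "\<lambda>c. c * _"]
          cong: if_cong)
    then show "(mat_adj (mat_unit (f i) i) ** b ** mat_unit (f i) i) $ x $ y
        = mat_scale (b $ f i $ f i) (mat_unit i i) $ x $ y"
      by (simp add: matrix_matrix_mult_def mat_unit_nth mat_scale_nth if_distrib[of "\<lambda>c. _ * c"]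
          cong: if_cong)
  qed
  then show "theta f b = (\<Sum>v\<leftarrow>map (\<lambda>i. mat_unit (f i) i) xs. mat_adj v ** b ** v)"
    using assms by (simp add: theta_def o_def sum_list_distinct_conv_sum_set)
qed

section \<open>Supports of the two operator systems\<close>

lemma graph_system_eq: "graph_system E = {m. \<forall>x y. m $ x $ y \<noteq> 0 \<longrightarrow> adj_or_eq E x y}"
proof
  show "graph_system E \<subseteq> {m. \<forall>x y. m $ x $ y \<noteq> 0 \<longrightarrow> adj_or_eq E x y}"
    using graph_system_nth_eq_0 by blast
  show "{m. \<forall>x y. m $ x $ y \<noteq> 0 \<longrightarrow> adj_or_eq E x y} \<subseteq> graph_system E"
  proof
    fix m :: "complex^'a^'a" assume m: "m \<in> {m. \<forall>x y. m $ x $ y \<noteq> 0 \<longrightarrow> adj_or_eq E x y}"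
    have "mat_scale (m $ x $ y) (mat_unit x y) \<in> graph_system E" for x y
    proof (cases "m $ x $ y = 0")
      case True
      then show ?thesis by (simp add: graph_system_def cmat.span_zero)
    next
      case False
      then show ?thesis
        using m unfolding graph_system_def by (blast intro: cmat.span_scale cmat.span_base)
    qed
    then show "m \<in> graph_system E"
      unfolding graph_system_def by (subst mat_unit_expand) (intro cmat.span_sum)
  qed
qed

lemma pullback_system_theta:
  "pullback_system EH (theta f) = {m. \<forall>x y. m $ x $ y \<noteq> 0 \<longrightarrow> adj_or_eq EH (f x) (f y)}"
proof -
  obtain xs :: "'a list" where "distinct xs" "set xs = UNIV"
    using finite_distinct_list[OF finite] by blast
  note k = kraus_rep_theta[OF this]
  show ?thesis
    unfolding pullback_system_eq[OF k] kraus_system_eq[OF k] theta_mat_unit_nth by simp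
qed

text \<open>Both systems consist of all matrices with support in a fixed set of positions. Such a
  space determines its set of positions, because \<open>mat_unit x y\<close> lies in it exactly when
  \<open>(x, y)\<close> is allowed.\<close>

lemma graph_system_eq_pullback_system_iff:
  "graph_system EG = pullback_system EH (theta f) \<longleftrightarrow> graph_pullback EG EH f"
proof
  assume eq: "graph_system EG = pullback_system EH (theta f)"
  have "adj_or_eq EG x y \<longleftrightarrow> adj_or_eq EH (f x) (f y)" for x y
  proof -
    have "adj_or_eq EG x y \<longleftrightarrow> mat_unit x y \<in> graph_system EG"
      by (simp add: graph_system_eq mat_unit_nth)
    also have "\<dots> \<longleftrightarrow> adj_or_eq EH (f x) (f y)"
      by (simp add: eq pullback_system_theta mat_unit_nth)
    finally show ?thesis .
  qed
  then show "graph_pullback EG EH f"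
    by (simp add: graph_pullback_def)
qed (simp add: graph_system_eq pullback_system_theta graph_pullback_def)

text \<open>This transfers the system from \<open>theta f\<close> to a map agreeing with it on
  \<open>diag_alg\<close> only: the two maps satisfy the same predicate \<open>kraus_rep\<close>, so
  \<open>SOME\<close> picks the same operators.\<close>

lemma pullback_system_cong:
  assumes "\<And>b. b \<in> diag_alg \<Longrightarrow> \<phi> b = \<psi> b"
  shows "pullback_system EH \<phi> = pullback_system EH \<psi>"
proof -
  have "kraus_rep \<phi> = kraus_rep \<psi>"
    using assms by (simp add: kraus_rep_def fun_eq_iff)
  then show ?thesis by (simp add: pullback_system_def)
qed

section \<open>Unital $*$-homomorphisms come from unique vertex maps\<close>

lemma theta_eq_imp_eq:
  assumes "\<And>b. b \<in> diag_alg \<Longrightarrow> theta f b = theta g b"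
  shows "f = g"
proof
  fix x
  have "theta g (mat_unit (f x) (f x)) $ x $ x \<noteq> 0"
    using assms[OF mat_unit_diag] theta_mat_unit_nth by metis
  then show "f x = g x" by (simp only: theta_mat_unit_nth)
qed

lemma diag_alg_expand:
  assumes "b \<in> diag_alg"
  shows "b = (\<Sum>w\<in>UNIV. mat_scale (b $ w $ w) (mat_unit w w))"
proof -
  \<comment> \<open>\<open>theta id\<close> keeps the diagonal of a matrix and deletes the rest, so
    its definition is the desired expansion.\<close>
  have "b = theta id b"
    using assms by (simp add: vec_eq_iff theta_nth diag_alg_def)
  then show ?thesis by (simp add: theta_def)
qed

lemma unital_star_hom_sum:
  assumes "unital_star_hom \<theta>" "finite A"
  shows "\<theta> (\<Sum>w\<in>A. mat_scale (c w) (mat_unit w w)) = (\<Sum>w\<in>A. mat_scale (c w) (\<theta> (mat_unit w w)))"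
  using assms(2)
proof (induction A rule: finite_induct)
  case empty
  \<comment> \<open>The value at 0 comes from homogeneity with scalar 0.\<close>
  have "\<theta> (mat_scale 0 0) = mat_scale 0 (\<theta> 0)"
    using assms(1) zero_diag_alg unfolding unital_star_hom_def by blast
  then show ?case by simp
next
  case (insert w A)
  have "mat_scale (c w) (mat_unit w w) \<in> diag_alg"
      "(\<Sum>w\<in>A. mat_scale (c w) (mat_unit w w)) \<in> diag_alg"
    by (auto simp: diag_alg_def mat_scale_nth mat_unit_nth intro!: sum.neutral)
  with insert show ?case
    using assms(1) unfolding unital_star_hom_def by (simp add: mat_unit_diag)
qed

lemma unital_star_hom_nth:
  assumes "unital_star_hom \<theta>" "b \<in> diag_alg"
  shows "\<theta> b $ x $ x = (\<Sum>w\<in>UNIV. b $ w $ w * \<theta> (mat_unit w w) $ x $ x)"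
  by (subst diag_alg_expand[OF assms(2)])
    (simp add: unital_star_hom_sum[OF assms(1)] mat_scale_nth)

text \<open>For fixed \<open>x\<close>, the numbers \<open>p w x\<close> are mutually orthogonal
  idempotents of the complex field with sum 1. Hence exactly one of them is 1 and the others are 0;
  \<open>f x\<close> is the index of that one.\<close>

lemma unital_star_hom_imp_theta:
  fixes \<theta> :: "complex^'h^'h \<Rightarrow> complex^'g^'g"
  assumes hom: "unital_star_hom \<theta>"
  obtains f where "\<And>b. b \<in> diag_alg \<Longrightarrow> \<theta> b = theta f b"
proof -
  have diag: "\<theta> b \<in> diag_alg" if "b \<in> diag_alg" for b
    using hom that by (simp add: unital_star_hom_def)
  define p where "p w x = \<theta> (mat_unit w w) $ x $ x" for w x
  have one: "mat 1 \<in> diag_alg" by (simp add: diag_alg_def mat_def)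
  have sum1: "(\<Sum>w\<in>UNIV. p w x) = 1" for x
    using unital_star_hom_nth[OF hom one, of x] hom
    by (simp add: p_def unital_star_hom_def mat_def)
  have mult: "p w x * p z x = (if w = z then p w x else 0)" for w z x
  proof -
    have "p w x * p z x = \<theta> (mat_unit w w ** mat_unit z z) $ x $ x"
      using hom by (simp add: p_def unital_star_hom_def mat_unit_diag diag_alg_mult_nth)
    also have "\<dots> = (\<Sum>u\<in>UNIV. if u = w then (if w = z then p w x else 0) else 0)"
    proof (subst unital_star_hom_nth[OF hom])
      show "mat_unit w w ** mat_unit z z \<in> diag_alg"
        by (intro mult_diag_alg mat_unit_diag)
      show "(\<Sum>u\<in>UNIV. (mat_unit w w ** mat_unit z z) $ u $ u * \<theta> (mat_unit u u) $ x $ x)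
          = (\<Sum>u\<in>UNIV. if u = w then (if w = z then p w x else 0) else 0)"
        by (intro sum.cong refl) (simp add: diag_alg_mult_nth mat_unit_diag mat_unit_nth p_def)
    qed
    finally show ?thesis by simp
  qed
  have "\<exists>w. p w x \<noteq> 0" for x
    using sum1[of x] by (metis sum.neutral zero_neq_one)
  then obtain f where f: "\<And>x. p (f x) x \<noteq> 0" by metis
  \<comment> \<open>Cancel the nonzero factor \<open>p (f x) x\<close> in \<open>mult\<close>: the
    case \<open>w = f x\<close> gives 1, any other \<open>w\<close> gives 0.\<close>
  have p: "p w x = (if w = f x then 1 else 0)" for w x
    using mult[of "f x" x w] f[of x] by (auto split: if_splits)
  have "\<theta> b = theta f b" if b: "b \<in> diag_alg" for b
  proof -
    have "\<theta> b $ x $ x = b $ f x $ f x" for x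
    proof -
      have "\<theta> b $ x $ x = (\<Sum>w\<in>UNIV. b $ w $ w * p w x)"
        using unital_star_hom_nth[OF hom b] by (simp add: p_def)
      also have "\<dots> = (\<Sum>w\<in>UNIV. if w = f x then b $ w $ w else 0)"
        by (intro sum.cong) (auto simp: p)
      finally show ?thesis by simp
    qed
    then show ?thesis
      using diag_algD[OF diag[OF b]] by (simp add: vec_eq_iff theta_nth)
  qed
  then show thesis by (rule that)
qed

section \<open>Surjectivity of \<open>f\<close> in terms of \<open>theta f\<close>\<close>

lemma inj_on_theta_iff:
  fixes f :: "'g::finite \<Rightarrow> 'h::finite"
  shows "inj_on (theta f) diag_alg \<longleftrightarrow> surj f"
proof
  assume inj: "inj_on (theta f) diag_alg"
  show "surj f"
  proof (rule ccontr)
    assume "\<not> surj f"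
    then obtain w where w: "w \<notin> range f" by blast
    \<comment> \<open>\<open>theta f\<close> reads only diagonal entries at vertices in the range of
      \<open>f\<close>, so a missed vertex \<open>w\<close> yields a nonzero element of the
      kernel.\<close>
    have "theta f (mat_unit w w) = theta f 0"
      using w by (auto simp: vec_eq_iff theta_nth mat_unit_nth)
    then have "mat_unit w w = (0 :: complex^'h^'h)"
      by (rule inj_onD[OF inj]) (rule mat_unit_diag zero_diag_alg)+
    then have "mat_unit w w $ w $ w = (0 :: complex)" by simp
    then show False by (simp add: mat_unit_nth)
  qed
next
  assume surj: "surj f"
  show "inj_on (theta f) diag_alg"
  proof (rule inj_onI)
    fix b c :: "complex^'h^'h"
    assume bc: "b \<in> diag_alg" "c \<in> diag_alg" and eq: "theta f b = theta f c"
    have "b $ w $ w = c $ w $ w" for w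
    proof -
      obtain x where "w = f x" using surj by blast
      then show ?thesis using arg_cong[OF eq, of "\<lambda>m. m $ x $ x"] by (simp add: theta_nth)
    qed
    then have "b $ w $ z = c $ w $ z" for w z
      using bc by (cases "w = z") (simp_all add: diag_algD)
    then show "b = c" by (simp add: vec_eq_iff)
  qed
qed

lemma bimodule_of_theta:
  fixes f :: "'g::finite \<Rightarrow> 'h::finite"
  shows "bimodule_of (theta f) = {m. \<forall>w x. m $ w $ x \<noteq> 0 \<longrightarrow> w = f x}"
proof -
  obtain xs :: "'g list" where xs: "distinct xs" "set xs = UNIV"
    using finite_distinct_list[OF finite] by blast
  show ?thesis
    unfolding bimodule_of_eq[OF kraus_rep_theta[OF xs]] kraus_space_supported supported_def
      kraus_nonzero_iff[OF kraus_rep_theta[OF xs]] theta_mat_unit_nth ..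
qed

lemma range_span_bimodule_of_theta_iff:
  fixes f :: "'g::finite \<Rightarrow> 'h::finite"
  shows "range_span (bimodule_of (theta f)) = UNIV \<longleftrightarrow> surj f"
proof
  assume full: "range_span (bimodule_of (theta f)) = UNIV"
  show "surj f"
  proof (rule ccontr)
    assume "\<not> surj f"
    then obtain w where w: "w \<notin> range f" by blast
    \<comment> \<open>Row \<open>w\<close> of every matrix in the bimodule is zero when
      \<open>f\<close> misses \<open>w\<close>, so all its images vanish at
      \<open>w\<close>.\<close>
    have "range_span (bimodule_of (theta f)) \<subseteq> {v. v $ w = 0}"
      unfolding range_span_def
    proof (rule vec.span_minimal)
      show "{m *v \<xi> | m \<xi>. m \<in> bimodule_of (theta f)} \<subseteq> {v. v $ w = 0}"
        using w by (force simp: bimodule_of_theta matrix_vector_mult_def intro!: sum.neutral)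
      show "vec.subspace {v :: complex^'h. v $ w = 0}"
        by (simp add: vec.subspace_def)
    qed
    then have "axis w (1::complex) $ w = 0" using full by blast
    then show False by simp
  qed
next
  assume surj: "surj f"
  have "axis w 1 \<in> range_span (bimodule_of (theta f))" for w
  proof -
    obtain x where x: "w = f x" using surj by blast
    \<comment> \<open>With \<open>w = f x\<close>, the matrix unit at \<open>(w, x)\<close> lies in
      the bimodule and sends one standard basis vector to the other.\<close>
    have "axis w 1 = mat_unit w x *v axis x (1::complex)"
      by (simp add: vec_eq_iff matrix_vector_mult_def mat_unit_nth axis_def
          if_distrib[of "\<lambda>c. _ * c"] cong: if_cong)
    moreover have "mat_unit w x \<in> bimodule_of (theta f)"
      by (simp add: bimodule_of_theta mat_unit_nth x)
    ultimately show ?thesis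
      unfolding range_span_def by (intro vec.span_base) blast
  qed
  then have "vec.span (cart_basis :: (complex^'h) set) \<subseteq> range_span (bimodule_of (theta f))"
    unfolding range_span_def
    by (intro vec.span_minimal vec.subspace_span) (auto simp: cart_basis_def)
  then show "range_span (bimodule_of (theta f)) = UNIV"
    by (simp add: span_cart_basis top.extremum_uniqueI)
qed

theorem proposition3p10:
  fixes EG :: "'g::finite \<Rightarrow> 'g \<Rightarrow> bool" and EH :: "'h::finite \<Rightarrow> 'h \<Rightarrow> bool"
  assumes "simple_graph EG" and "simple_graph EH"
  shows
    "(\<forall>f :: 'g \<Rightarrow> 'h. graph_pullback EG EH f \<longrightarrow>
        unital_star_hom (theta f) \<and> graph_system EG = pullback_system EH (theta f)) \<and>
     (\<forall>\<theta> :: complex^'h^'h \<Rightarrow> complex^'g^'g.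
        unital_star_hom \<theta> \<and> graph_system EG = pullback_system EH \<theta> \<longrightarrow>
        (\<exists>!f :: 'g \<Rightarrow> 'h. graph_pullback EG EH f \<and> (\<forall>b\<in>diag_alg. \<theta> b = theta f b))) \<and>
     (\<forall>f :: 'g \<Rightarrow> 'h. graph_pullback EG EH f \<longrightarrow>
        (surj f \<longleftrightarrow> inj_on (theta f) diag_alg) \<and>
        (inj_on (theta f) diag_alg \<longleftrightarrow> range_span (bimodule_of (theta f)) = UNIV))"
proof (intro conjI allI impI)
  fix f :: "'g \<Rightarrow> 'h"
  assume f: "graph_pullback EG EH f"
  show "unital_star_hom (theta f)" by (rule unital_star_hom_theta)
  show "graph_system EG = pullback_system EH (theta f)"
    using f by (simp add: graph_system_eq_pullback_system_iff)
  show "surj f \<longleftrightarrow> inj_on (theta f) diag_alg"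
    by (simp add: inj_on_theta_iff)
  show "inj_on (theta f) diag_alg \<longleftrightarrow> range_span (bimodule_of (theta f)) = UNIV"
    by (simp add: inj_on_theta_iff range_span_bimodule_of_theta_iff)
next
  fix \<theta> :: "complex^'h^'h \<Rightarrow> complex^'g^'g"
  assume \<theta>: "unital_star_hom \<theta> \<and> graph_system EG = pullback_system EH \<theta>"
  then obtain f where f: "\<And>b. b \<in> diag_alg \<Longrightarrow> \<theta> b = theta f b"
    using unital_star_hom_imp_theta by blast
  have "graph_pullback EG EH f"
    using \<theta> pullback_system_cong[of \<theta> "theta f", OF f] graph_system_eq_pullback_system_iff
    by metis
  moreover have "g = f" if "\<forall>b\<in>diag_alg. \<theta> b = theta g b" for g
    using that f by (intro theta_eq_imp_eq) simp
  ultimately show "\<exists>!f. graph_pullback EG EH f \<and> (\<forall>b\<in>diag_alg. \<theta> b = theta f b)"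
    using f by blast
qed

end
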